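(* Consider the problem (P) of minimizing $\tfrac12 x^THx+c^Tx+f_0(y)$ over $(x,y)\in\mathbb{R}^n\times\mathbb{R}^m$ subject to $x^Tx+f_1(y)\le 0$ and $f_j(y)\le 0$ for $j=2,\dots,k$, where $n\ge 2$, $H=H^T\in\mathbb{R}^{n\times n}$ is not positive semidefinite, $c\in\mathbb{R}^n$, $k\ge 1$, and $f_0,f_1,\dots,f_k:\mathbb{R}^m\to\mathbb{R}$ are convex and twice continuously differentiable. Let $\lambda_1\le\lambda_2\le\dots\le\lambda_n$ be the eigenvalues of $H$ counted with multiplicity. Let $(x_*,y_* )$ be a local non-global minimizer of (P), and assume that the gradients $\nabla f_i(y_* )$, $i\in\{j\in\{1,\dots,k\}: f_j(y_* )=0\}$, are linearly independent. Then: (1) $\lambda_1<\lambda_2$; (2) there exist $\mu_j^*\ge 0$, $j=1,\dots,k$, with $\max\{0,-\lambda_2\}<\mu_1^*<-\lambda_1$, such that $$(H+\mu_1^*I)x_*+c=0,$$ $$\nabla f_0(y_* )+\tfrac{\mu_1^*}{2}\nabla f_1(y_* )+\sum_{j=2}^k\mu_j^*\nabla f_j(y_* )=0,$$ $$x_*^Tx_*+f_1(y_* )=0,\qquad \mu_j^*f_j(y_* )=0\ \ (j=2,\dots,k);$$ (3) $c$ is not orthogonal to any eigenvector of $H$ associated with $\lambda_1$.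
   Context: A local non-global minimizer of a constrained problem is a feasible point that is a local minimizer but not a global minimizer. $I$ is the $n\times n$ identity matrix. *)

theory Defs
  imports "HOL-Analysis.Analysis" "HOL-Computational_Algebra.Polynomial"
begin

definition gradient :: "('a::real_inner \<Rightarrow> real) \<Rightarrow> 'a \<Rightarrow> 'a" where
  "gradient f x = (THE D. GDERIV f x :> D)"

lemma gradient_eqI:
  assumes "GDERIV f x :> D"
  shows "gradient f x = D"
  unfolding gradient_def
proof (rule the_equality)
  fix E assume "GDERIV f x :> E"
  with assms have "(\<lambda>h. inner h D) = (\<lambda>h. inner h E)"
    unfolding gderiv_def by (rule has_derivative_unique)
  then have "inner h (E - D) = 0" for h :: 'a
    by (simp add: inner_diff_right fun_eq_iff)
  then show "E = D"
    using inner_eq_zero_iff[of "E - D"] by simp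
qed (fact assms)

definition twice_cont_diff :: "(real^'m \<Rightarrow> real) \<Rightarrow> bool" where
  "twice_cont_diff f \<longleftrightarrow>
     (\<exists>(g :: real^'m \<Rightarrow> real^'m) (G :: real^'m \<Rightarrow> real^'m^'m).
        (\<forall>y. GDERIV f y :> g y) \<and>
        (\<forall>y. (g has_derivative (\<lambda>h. G y *v h)) (at y)) \<and>
        continuous_on UNIV G)"

text \<open>Independence of a family rather than of the set of its values: repeated vectors
  make the family dependent.\<close>

definition lin_indep_family :: "('i \<Rightarrow> 'a::real_vector) \<Rightarrow> 'i set \<Rightarrow> bool" where
  "lin_indep_family v I \<longleftrightarrow> inj_on v I \<and> independent (v ` I)"

definition pos_semidef :: "real^'n^'n \<Rightarrow> bool" where
  "pos_semidef A \<longleftrightarrow> transpose A = A \<and> (\<forall>x. 0 \<le> x \<bullet> (A *v x))"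

definition charpoly :: "real^'n^'n \<Rightarrow> real poly" where
  "charpoly A = det (\<chi> i j. (if i = j then [:0, 1:] else 0) - [:A $ i $ j:])"

text \<open>The values \<open>lam 1 \<le> \<dots> \<le> lam n\<close> are the eigenvalues of the \<open>n\<close>-by-\<open>n\<close> matrix \<open>A\<close>,
  counted with multiplicity (as roots of the characteristic polynomial). For symmetric
  \<open>A\<close> they exist, and \<open>lam\<close> is determined on \<open>{1..n}\<close>.\<close>

definition ordered_eigenvalues :: "real^'n^'n \<Rightarrow> (nat \<Rightarrow> real) \<Rightarrow> bool" where
  "ordered_eigenvalues A lam \<longleftrightarrow>
     mono_on {1..CARD('n)} lam \<and> charpoly A = (\<Prod>i = 1..CARD('n). [:- lam i, 1:])"

definition is_eigenvector :: "real^'n^'n \<Rightarrow> real \<Rightarrow> real^'n \<Rightarrow> bool" where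
  "is_eigenvector A l v \<longleftrightarrow> v \<noteq> 0 \<and> A *v v = l *\<^sub>R v"

definition objective ::
  "real^'n^'n \<Rightarrow> real^'n \<Rightarrow> (nat \<Rightarrow> real^'m \<Rightarrow> real) \<Rightarrow> (real^'n) \<times> (real^'m) \<Rightarrow> real" where
  "objective H c f = (\<lambda>(x, y). 1/2 * (x \<bullet> (H *v x)) + c \<bullet> x + f 0 y)"

definition feasible_set ::
  "nat \<Rightarrow> (nat \<Rightarrow> real^'m \<Rightarrow> real) \<Rightarrow> ((real^'n) \<times> (real^'m)) set" where
  "feasible_set k f = {(x, y). x \<bullet> x + f 1 y \<le> 0 \<and> (\<forall>j\<in>{2..k}. f j y \<le> 0)}"

definition global_minimizer :: "('a \<Rightarrow> real) \<Rightarrow> 'a set \<Rightarrow> 'a \<Rightarrow> bool" where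
  "global_minimizer F S p \<longleftrightarrow> p \<in> S \<and> (\<forall>q\<in>S. F p \<le> F q)"

definition local_minimizer :: "('a::metric_space \<Rightarrow> real) \<Rightarrow> 'a set \<Rightarrow> 'a \<Rightarrow> bool" where
  "local_minimizer F S p \<longleftrightarrow> p \<in> S \<and> (\<exists>e>0. \<forall>q\<in>S \<inter> ball p e. F p \<le> F q)"

definition local_nonglobal_minimizer ::
  "('a::metric_space \<Rightarrow> real) \<Rightarrow> 'a set \<Rightarrow> 'a \<Rightarrow> bool" where
  "local_nonglobal_minimizer F S p \<longleftrightarrow> local_minimizer F S p \<and> \<not> global_minimizer F S p"

end

theory Submission
  imports Defs
begin

text \<open>If the ball constraint were inactive, \<open>H\<close> would be positive semidefinite. So it is active, and
  multipliers exist by Gordan's alternative and the independence of the gradients. Put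
  \<open>A = H + \<mu>\<^sub>1 I\<close>. If \<open>A\<close> were positive semidefinite, the Lagrangian would be convex and the point a
  global minimizer; hence \<open>\<mu>\<^sub>1 < - \<lambda>\<^sub>1\<close>, and also \<open>x \<noteq> 0\<close>. Moving along chords of the sphere through \<open>x\<close>
  with \<open>y\<close> fixed shows that the form of \<open>A\<close> is nonnegative on all nearly tangent directions. This is
  contradicted by a vector of the plane of the first two eigenvectors if \<open>\<mu>\<^sub>1 \<le> - \<lambda>\<^sub>2\<close>, and by a
  \<open>\<lambda>\<^sub>1\<close>-eigenvector \<open>v\<close> if \<open>c\<close> is orthogonal to it, since then \<open>v\<close> is tangent. Finally
  \<open>\<mu>\<^sub>1 = 0\<close> would make \<open>H\<close> nonnegative on all inward directions, hence everywhere.\<close>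

section \<open>Extreme eigenvalues of symmetric matrices\<close>

lemma poly_det: "poly (det M) t = det (\<chi> i j. poly (M $ i $ j) t)"
  for M :: "'a::comm_ring_1 poly^'n^'n"
proof -
  \<comment> \<open>The Leibniz formula contains permutation signs through \<open>of_int\<close>;
    evaluation leaves these constants unchanged.\<close>
  have "poly (of_int z) t = of_int z" for z :: int
    by (simp add: of_int_poly)
  then show ?thesis
    by (simp add: det_def poly_sum poly_prod)
qed

lemma poly_charpoly: "poly (charpoly A) t = det (t *\<^sub>R mat 1 - A)"
  unfolding charpoly_def poly_det
  by (rule arg_cong[where f=det]) (simp add: vec_eq_iff mat_def)

lemma charpoly_root_iff: "poly (charpoly A) t = 0 \<longleftrightarrow> (\<exists>v. is_eigenvector A t v)"
proof -
  have "det (t *\<^sub>R mat 1 - A) = 0 \<longleftrightarrow> (\<exists>v. v \<noteq> 0 \<and> (t *\<^sub>R mat 1 - A) *v v = 0)"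
    by (metis invertible_det_nz invertible_left_inverse matrix_left_invertible_ker
        matrix_vector_mult_0_right)
  then show ?thesis
    by (simp add: poly_charpoly is_eigenvector_def matrix_vector_mult_diff_rdistrib
        flip: scaleR_matrix_vector_assoc) (metis)
qed

lemma symmetric_matrix_inner:
  assumes "transpose A = A"
  shows "x \<bullet> (A *v y) = (A *v x) \<bullet> (y :: real^'n)"
  by (metis assms dot_lmul_matrix transpose_matrix_vector)

lemma eigenvector_normalize:
  assumes "is_eigenvector A l v"
  shows "is_eigenvector A l (v /\<^sub>R norm v)" "norm (v /\<^sub>R norm v) = 1"
  using assms by (auto simp: is_eigenvector_def matrix_vector_mult_scaleR)

text \<open>The polynomial vanishes at 0 and is nonnegative, so 0 is a minimum and its derivative
  there, \<open>a\<close>, is zero.\<close>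

lemma linear_coefficient_eq_0:
  fixes a b :: real
  assumes "\<And>t. 0 \<le> a * t + b * t\<^sup>2"
  shows "a = 0"
proof (rule DERIV_local_min)
  show "((\<lambda>t. a * t + b * t\<^sup>2) has_real_derivative a) (at 0)"
    by (auto intro!: derivative_eq_intros)
  show "\<forall>t. \<bar>0 - t\<bar> < 1 \<longrightarrow> a * 0 + b * 0\<^sup>2 \<le> a * t + b * t\<^sup>2"
    using assms by simp
qed simp

text \<open>A zero \<open>v\<close> of a nonnegative form minimizes it. Perturbing \<open>v\<close>
  by \<open>t\<close> times \<open>A *v v\<close> produces the linear coefficient
  \<open>2 * (?w \<bullet> ?w)\<close>, which must vanish.\<close>

lemma nonneg_form_null_vector:
  fixes A :: "real^'n^'n"
  assumes sym: "transpose A = A" and nonneg: "\<And>x. 0 \<le> x \<bullet> (A *v x)"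
    and v: "v \<bullet> (A *v v) = 0"
  shows "A *v v = 0"
proof -
  let ?w = "A *v v"
  have "0 \<le> (2 * (?w \<bullet> ?w)) * t + (?w \<bullet> (A *v ?w)) * t\<^sup>2" for t
  proof -
    have "(v + t *\<^sub>R ?w) \<bullet> (A *v (v + t *\<^sub>R ?w)) =
        v \<bullet> ?w + t * (v \<bullet> (A *v ?w)) + t * (?w \<bullet> ?w) + t\<^sup>2 * (?w \<bullet> (A *v ?w))"
      by (simp add: matrix_vector_right_distrib matrix_vector_mult_scaleR inner_add_left
          inner_add_right power2_eq_square distrib_left)
    with nonneg[of "v + t *\<^sub>R ?w"] show ?thesis
      by (simp add: v symmetric_matrix_inner[OF sym, of v ?w] power2_eq_square algebra_simps)
  qed
  from linear_coefficient_eq_0[OF this] show ?thesis by simp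
qed

text \<open>The form attains a minimum \<open>l\<close> on the compact unit sphere, and homogeneity
  extends the bound to all vectors. A minimizer is then a null vector of the nonnegative form of
  \<open>A - l *\<^sub>R mat 1\<close>, hence an eigenvector.\<close>

lemma symmetric_min_eigenvector:
  fixes A :: "real^'n^'n"
  assumes sym: "transpose A = A"
  obtains l v where "is_eigenvector A l v" "\<And>x. l * (x \<bullet> x) \<le> x \<bullet> (A *v x)"
proof -
  have "continuous_on (sphere 0 1) (\<lambda>x. x \<bullet> (A *v x))"
    by (intro continuous_on_inner continuous_on_id matrix_vector_mult_linear_continuous_on)
  then obtain v where v: "norm v = 1"
    and min: "\<And>x. norm x = 1 \<Longrightarrow> v \<bullet> (A *v v) \<le> x \<bullet> (A *v x)"
    using continuous_attains_inf[of "sphere 0 1 :: (real^'n) set" "\<lambda>x. x \<bullet> (A *v x)"]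
    by fastforce
  define l where "l = v \<bullet> (A *v v)"
  have ge: "l * (x \<bullet> x) \<le> x \<bullet> (A *v x)" for x
  proof (cases "x = 0")
    case False
    then have "l \<le> (x /\<^sub>R norm x) \<bullet> (A *v (x /\<^sub>R norm x))"
      unfolding l_def by (intro min) simp
    also have "\<dots> = (x \<bullet> (A *v x)) / (norm x)\<^sup>2"
      by (simp add: matrix_vector_mult_scaleR power2_eq_square divide_inverse)
    finally show ?thesis
      using False by (simp add: pos_le_divide_eq power2_norm_eq_inner)
  qed simp
  have shift: "(A - l *\<^sub>R mat 1) *v x = A *v x - l *\<^sub>R x" for x
    by (simp add: matrix_vector_mult_diff_rdistrib flip: scaleR_matrix_vector_assoc)
  have "(A - l *\<^sub>R mat 1) *v v = 0"
  proof (rule nonneg_form_null_vector)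
    show "transpose (A - l *\<^sub>R mat 1) = A - l *\<^sub>R mat 1"
      using sym by (auto simp: vec_eq_iff transpose_def mat_def)
    show "0 \<le> x \<bullet> ((A - l *\<^sub>R mat 1) *v x)" for x
      using ge[of x] by (simp add: shift inner_diff_right)
    show "v \<bullet> ((A - l *\<^sub>R mat 1) *v v) = 0"
      using v by (simp add: shift inner_diff_right norm_eq_1) (simp add: l_def)
  qed
  then have "is_eigenvector A l v"
    using v by (auto simp: is_eigenvector_def shift)
  then show ?thesis using ge that by blast
qed

text \<open>\<open>R\<close> is the identity plus \<open>s\<close> times the projection onto the
  line of \<open>v\<close>. In an orthonormal basis containing \<open>v\<close> it is diagonal, with
  one entry \<open>1 + s\<close> and all others 1.\<close>

lemma det_rank_one_update:
  fixes v :: "real^'n"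
  assumes "norm v = 1"
  obtains R :: "real^'n^'n" where "det R = 1 + s" "\<And>x. R *v x = x + (s * (v \<bullet> x)) *\<^sub>R v"
proof -
  fix k :: 'n
  obtain P :: "real^'n^'n" where P: "orthogonal_matrix P" "P *v axis k 1 = v"
    using orthogonal_matrix_exists_basis[OF assms] by blast
  have PT: "P ** transpose P = mat 1"
    using P(1) by (simp add: orthogonal_matrix_def)
  define D :: "real^'n^'n" where
    "D = (\<chi> i j. if i = j then (if i = k then 1 + s else 1) else 0)"
  have "det D = (\<Prod>i\<in>UNIV. if i = k then 1 + s else 1)"
    by (subst det_diagonal) (auto simp: D_def)
  then have detD: "det D = 1 + s" by simp
  have D: "D *v y = y + (s * (axis k 1 \<bullet> y)) *\<^sub>R axis k 1" for y
  proof -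
    have "(D *v y) $ i = (if i = k then 1 + s else 1) * y $ i" for i
    proof -
      have "(D *v y) $ i = (\<Sum>j\<in>UNIV. if i = j then (if i = k then 1 + s else 1) * y $ j else 0)"
        unfolding matrix_vector_mult_def vec_lambda_beta by (rule sum.cong) (auto simp: D_def)
      then show ?thesis by simp
    qed
    then show ?thesis
      by (simp add: inner_axis') (simp add: vec_eq_iff axis_def algebra_simps)
  qed
  show ?thesis
  proof
    have "det P * det P = 1"
      using arg_cong[OF PT, of det] by (simp add: det_mul)
    then show "det (P ** D ** transpose P) = 1 + s"
      by (simp add: det_mul detD algebra_simps)
    show "(P ** D ** transpose P) *v x = x + (s * (v \<bullet> x)) *\<^sub>R v" for x
    proof -
      have "axis k 1 \<bullet> (transpose P *v x) = v \<bullet> x"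
        by (metis P(2) dot_lmul_matrix inner_commute transpose_matrix_vector)
      moreover have "P *v (transpose P *v x) = x"
        by (metis PT matrix_vector_mul_assoc matrix_vector_mul_lid)
      ultimately show ?thesis
        by (simp add: P(2) D matrix_vector_right_distrib matrix_vector_mult_scaleR
            del: transpose_matrix_vector flip: matrix_vector_mul_assoc)
    qed
  qed
qed

lemma continuous_on_det:
  fixes M :: "'a::topological_space \<Rightarrow> real^'n^'n"
  assumes "continuous_on S M"
  shows "continuous_on S (\<lambda>t. det (M t))"
  unfolding det_def by (intro continuous_intros assms)

text \<open>Deflation: correcting \<open>t I - A\<close> to act as the identity on \<open>v\<close> divides its determinant
  by \<open>t - l\<close>, so at a double root the corrected matrix is still singular.\<close>

lemma double_root_orthogonal_eigenvector:
  fixes A :: "real^'n^'n"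
  assumes sym: "transpose A = A" and ev: "is_eigenvector A l v"
    and root: "\<And>t. poly (charpoly A) t = (t - l)\<^sup>2 * poly r t"
  obtains w where "is_eigenvector A l w" "v \<bullet> w = 0"
proof -
  define u where "u = v /\<^sub>R norm v"
  have u: "is_eigenvector A l u" "norm u = 1"
    using eigenvector_normalize[OF ev] by (auto simp: u_def)
  have Au: "A *v u = l *\<^sub>R u" and uu: "u \<bullet> u = 1"
    using u by (auto simp: is_eigenvector_def norm_eq_1)
  have uA: "u \<bullet> (A *v x) = l * (u \<bullet> x)" for x
    by (simp add: symmetric_matrix_inner[OF sym] Au)
  define W :: "real^'n^'n" where "W = (\<chi> i j. u $ i * u $ j)"
  have W: "W *v x = (u \<bullet> x) *\<^sub>R u" for x
    by (simp add: vec_eq_iff W_def matrix_vector_mult_def inner_vec_def sum_distrib_left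
        sum_distrib_right algebra_simps)
  define N where "N t = t *\<^sub>R mat 1 - A + (1 - t + l) *\<^sub>R W" for t
  have N: "N t *v x = t *\<^sub>R x - A *v x + ((1 - t + l) * (u \<bullet> x)) *\<^sub>R u" for t x
    by (simp add: N_def matrix_vector_mult_diff_rdistrib matrix_vector_mult_add_rdistrib W
        flip: scaleR_matrix_vector_assoc)
  have factor: "poly (charpoly A) t = det (N t) * (t - l)" for t
  proof -
    obtain R :: "real^'n^'n" where R: "det R = 1 + (t - l - 1)"
      "\<And>x. R *v x = x + ((t - l - 1) * (u \<bullet> x)) *\<^sub>R u"
      using det_rank_one_update[OF u(2)] by blast
    \<comment> \<open>\<open>N t\<close> fixes \<open>u\<close>, while \<open>R\<close> multiplies
      \<open>u\<close> by \<open>t - l\<close> and is the identity on its orthogonal complement; the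
      product therefore has the eigenvalue \<open>t - l\<close> at \<open>u\<close> again.\<close>
    have "N t ** R = t *\<^sub>R mat 1 - A"
    proof (subst matrix_eq, intro allI)
      fix x
      have "N t *v u = u"
        by (simp add: N Au uu algebra_simps)
      then have "N t *v (R *v x) = N t *v x + ((t - l - 1) * (u \<bullet> x)) *\<^sub>R u"
        by (simp add: R(2) matrix_vector_right_distrib matrix_vector_mult_scaleR)
      also have "\<dots> = t *\<^sub>R x - A *v x"
        by (simp add: N algebra_simps)
      finally show "(N t ** R) *v x = (t *\<^sub>R mat 1 - A) *v x"
        by (simp add: matrix_vector_mult_diff_rdistrib flip: matrix_vector_mul_assoc
            scaleR_matrix_vector_assoc)
    qed
    then show ?thesis
      by (metis R(1) det_mul poly_charpoly add.commute diff_add_cancel)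
  qed
  \<comment> \<open>Cancelling \<open>t - l\<close> is possible only for \<open>t\<close> different
    from \<open>l\<close>; continuity carries the resulting identity over to
    \<open>t = l\<close>.\<close>
  have "continuous_on UNIV (\<lambda>t. det (N t) - (t - l) * poly r t)"
    unfolding N_def by (intro continuous_intros continuous_on_det)
  then have "((\<lambda>t. det (N t) - (t - l) * poly r t) \<longlongrightarrow> det (N l) - (l - l) * poly r l) (at l)"
    unfolding continuous_on_def by (rule bspec) simp
  moreover have "\<forall>\<^sub>F t in at l. det (N t) - (t - l) * poly r t = 0"
  proof -
    have "det (N t) - (t - l) * poly r t = 0" if "t \<noteq> l" for t
      using factor[of t] root[of t] that by (simp add: power2_eq_square)
    then show ?thesis by (auto simp: eventually_at_filter)
  qed
  ultimately have "((\<lambda>t. 0) \<longlongrightarrow> det (N l) - (l - l) * poly r l) (at l)"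
    using tendsto_cong by fast
  then have "det (N l) = 0"
    by (simp add: tendsto_const_iff)
  then obtain w where w: "w \<noteq> 0" "N l *v w = 0"
    by (metis invertible_det_nz invertible_left_inverse matrix_left_invertible_ker)
  \<comment> \<open>\<open>N l\<close> preserves the component along \<open>u\<close>, so its kernel
    is orthogonal to \<open>u\<close>; there \<open>N l\<close> agrees with
    \<open>l I - A\<close>.\<close>
  have "u \<bullet> (N l *v w) = u \<bullet> w"
    by (simp add: N inner_diff_right inner_add_right uA uu)
  with w have uw: "u \<bullet> w = 0" by simp
  with w have "is_eigenvector A l w"
    by (simp add: N is_eigenvector_def)
  moreover have "v \<bullet> w = 0"
    using uw ev by (simp add: u_def is_eigenvector_def)
  ultimately show ?thesis using that by blast
qed

section \<open>The ordered list of eigenvalues\<close>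

lemma ordered_eigenvalues_root:
  fixes A :: "real^'n^'n"
  assumes "ordered_eigenvalues A lam" "i \<in> {1..CARD('n)}"
  obtains v where "is_eigenvector A (lam i) v"
proof -
  have "poly (charpoly A) (lam i) = (\<Prod>j = 1..CARD('n). lam i - lam j)"
    using assms(1) by (simp add: ordered_eigenvalues_def poly_prod)
  also have "\<dots> = 0"
    using assms(2) by (auto intro: prod_zero)
  finally show ?thesis using charpoly_root_iff that by blast
qed

text \<open>The minimum of the form on the unit sphere is an eigenvalue, hence some
  \<open>lam j\<close>, and \<open>lam 1\<close> is at most \<open>lam j\<close> by
  monotonicity.\<close>

lemma ordered_eigenvalues_quadratic_form_ge:
  fixes A :: "real^'n^'n"
  assumes sym: "transpose A = A" and eigs: "ordered_eigenvalues A lam"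
  shows "lam 1 * (x \<bullet> x) \<le> x \<bullet> (A *v x)"
proof -
  obtain l v where lv: "is_eigenvector A l v" and ge: "\<And>x. l * (x \<bullet> x) \<le> x \<bullet> (A *v x)"
    using symmetric_min_eigenvector[OF sym] by blast
  have "poly (charpoly A) l = 0"
    using lv charpoly_root_iff by blast
  then have "(\<Prod>j = 1..CARD('n). l - lam j) = 0"
    using eigs by (simp add: ordered_eigenvalues_def poly_prod)
  then obtain j where j: "j \<in> {1..CARD('n)}" "l = lam j"
    by auto
  have "lam 1 \<le> lam j"
    using eigs j(1) unfolding ordered_eigenvalues_def
    by (auto intro: mono_onD)
  then have "lam 1 * (x \<bullet> x) \<le> l * (x \<bullet> x)"
    by (simp add: j mult_right_mono)
  with ge[of x] show ?thesis by simp
qed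

text \<open>Eigenvectors of a symmetric matrix for distinct eigenvalues are orthogonal. If
  \<open>lam 1 = lam 2\<close>, this value is a double root of the characteristic polynomial and
  deflation supplies the second vector.\<close>

lemma ordered_eigenvalues_orthogonal_pair:
  fixes A :: "real^'n^'n"
  assumes sym: "transpose A = A" and eigs: "ordered_eigenvalues A lam" and n: "CARD('n) \<ge> 2"
  obtains v w where "is_eigenvector A (lam 1) v" "is_eigenvector A (lam 2) w" "v \<bullet> w = 0"
proof -
  obtain v where v: "is_eigenvector A (lam 1) v"
    using ordered_eigenvalues_root[OF eigs, of 1] n by auto
  obtain w where w: "is_eigenvector A (lam 2) w"
    using ordered_eigenvalues_root[OF eigs, of 2] n by auto
  show ?thesis
  proof (cases "lam 1 = lam 2")
    case True
    have "poly (charpoly A) t = (\<Prod>i = 1..CARD('n). t - lam i)" for t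
      using eigs by (simp add: ordered_eigenvalues_def poly_prod)
    moreover have "{1..CARD('n)} = insert 1 (insert 2 {3..CARD('n)})"
      using n by auto
    ultimately have "poly (charpoly A) t = (t - lam 1)\<^sup>2 * poly (\<Prod>i = 3..CARD('n). [:- lam i, 1:]) t" for t
      using True by (simp add: poly_prod power2_eq_square)
    then show ?thesis
      using double_root_orthogonal_eigenvector[OF sym v] True that v by metis
  next
    case False
    have "v \<bullet> (A *v w) = (A *v v) \<bullet> w"
      by (rule symmetric_matrix_inner[OF sym])
    then have "lam 2 * (v \<bullet> w) = lam 1 * (v \<bullet> w)"
      using v w by (simp add: is_eigenvector_def)
    with False show ?thesis using that v w by auto
  qed
qed

section \<open>Theorems of the alternative and first-order conditions\<close>

text \<open>If 0 were outside the compact convex hull of the vectors, the normal of a strictly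
  separating hyperplane, with reversed sign, would have negative inner product with all of
  them.\<close>

lemma gordan_alternative:
  fixes v :: "'i \<Rightarrow> 'a::euclidean_space"
  assumes fin: "finite I" and ne: "I \<noteq> {}" and alt: "\<And>d. \<exists>i\<in>I. 0 \<le> v i \<bullet> d"
  obtains a where "\<And>i. i \<in> I \<Longrightarrow> 0 \<le> a i" "sum a I = 1" "(\<Sum>i\<in>I. a i *\<^sub>R v i) = 0"
proof -
  let ?C = "{y. \<exists>a. (\<forall>i\<in>I. 0 \<le> a i) \<and> sum a I = 1 \<and> (\<Sum>i\<in>I. a i *\<^sub>R v i) = y}"
  have "0 \<in> convex hull (v ` I)"
  proof (rule ccontr)
    assume "0 \<notin> convex hull (v ` I)"
    moreover have "closed (convex hull (v ` I))"
      by (simp add: fin compact_imp_closed finite_imp_compact_convex_hull)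
    moreover have "convex hull (v ` I) \<noteq> {}"
      using ne by simp
    ultimately obtain d b where "d \<in> convex hull (v ` I)" "d \<noteq> 0" "0 < b"
      and d: "\<And>x. x \<in> convex hull (v ` I) \<Longrightarrow> d \<bullet> x > b"
      by (metis separating_hyperplane_closed_0_inset convex_convex_hull)
    have "v i \<bullet> (- d) < 0" if "i \<in> I" for i
      using d[of "v i"] \<open>0 < b\<close> that by (simp add: hull_inc inner_commute)
    then show False
      using alt[of "- d"] by fastforce
  qed
  \<comment> \<open>Weights are needed on indices, not on values, since \<open>v\<close> may repeat
    a vector.\<close>
  also have "convex hull (v ` I) \<subseteq> ?C"
  proof (rule hull_minimal)
    show "v ` I \<subseteq> ?C"
    proof clarify
      fix i assume i: "i \<in> I"
      let ?a = "\<lambda>j. if j = i then 1 else 0 :: real"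
      have "(\<Sum>j\<in>I. ?a j *\<^sub>R v j) = v i"
        using fin i by (simp add: if_distribR if_distrib sum.delta cong: if_cong)
      then show "\<exists>a. (\<forall>j\<in>I. 0 \<le> a j) \<and> sum a I = 1 \<and> (\<Sum>j\<in>I. a j *\<^sub>R v j) = v i"
        using fin i by (intro exI[of _ ?a]) simp
    qed
    show "convex ?C"
    proof (rule convexI, clarify)
      fix a b :: "'i \<Rightarrow> real" and s t :: real
      assume st: "0 \<le> s" "0 \<le> t" "s + t = 1"
        and a: "\<forall>i\<in>I. 0 \<le> a i" "sum a I = 1" and b: "\<forall>i\<in>I. 0 \<le> b i" "sum b I = 1"
      show "\<exists>e. (\<forall>i\<in>I. 0 \<le> e i) \<and> sum e I = 1 \<and>
          (\<Sum>i\<in>I. e i *\<^sub>R v i) = s *\<^sub>R (\<Sum>i\<in>I. a i *\<^sub>R v i) + t *\<^sub>R (\<Sum>i\<in>I. b i *\<^sub>R v i)"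
        using st a b
        by (intro exI[of _ "\<lambda>i. s * a i + t * b i"])
          (simp add: sum.distrib scaleR_sum_right scaleR_left_distrib flip: sum_distrib_left)
    qed
  qed
  finally show ?thesis using that by blast
qed

text \<open>The values \<open>b\<close> prescribe a linear functional on the independent set, well
  defined because \<open>v\<close> is injective on \<open>I\<close>; its adjoint at 1 is the
  representing vector.\<close>

lemma lin_indep_family_dual:
  fixes v :: "'i \<Rightarrow> 'a::euclidean_space"
  assumes "lin_indep_family v I"
  obtains w where "\<And>i. i \<in> I \<Longrightarrow> v i \<bullet> w = b i"
proof -
  from assms have inj: "inj_on v I" and ind: "independent (v ` I)"
    by (auto simp: lin_indep_family_def)
  have "\<exists>g. linear g \<and> (\<forall>x\<in>v ` I. g x = b (inv_into I v x))"
    by (rule linear_independent_extend[OF ind])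
  then obtain g :: "'a \<Rightarrow> real"
    where g: "linear g" "\<forall>x\<in>v ` I. g x = b (inv_into I v x)"
    by (elim exE conjE)
  have "v i \<bullet> adjoint g 1 = b i" if "i \<in> I" for i
    using that by (simp add: adjoint_works[OF g(1)] g(2) inj)
  then show ?thesis using that by blast
qed

text \<open>Pairing the relation with a dual vector of \<open>v i\<close> isolates
  \<open>a i\<close>. Only the support of \<open>a\<close> has to lie in \<open>J\<close>: the index
  of the ball constraint can occur in the sum without belonging to \<open>J\<close>.\<close>

lemma lin_indep_family_sum_eq_0:
  fixes v :: "'i \<Rightarrow> 'a::euclidean_space"
  assumes "lin_indep_family v J" "finite I" "(\<Sum>i\<in>I. a i *\<^sub>R v i) = 0"
    and supp: "\<And>i. i \<in> I \<Longrightarrow> a i \<noteq> 0 \<Longrightarrow> i \<in> J" and i: "i \<in> I"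
  shows "a i = 0"
proof (rule ccontr)
  assume ai: "a i \<noteq> 0"
  obtain w where w: "\<And>j. j \<in> J \<Longrightarrow> v j \<bullet> w = (if j = i then 1 else 0)"
    using lin_indep_family_dual[OF assms(1), where b = "\<lambda>j. if j = i then 1 else 0"] by auto
  have "0 = (\<Sum>j\<in>I. a j *\<^sub>R v j) \<bullet> w"
    by (simp add: assms(3))
  also have "\<dots> = (\<Sum>j\<in>I. if j = i then a i else 0)"
    unfolding inner_sum_left
  proof (rule sum.cong)
    fix j assume "j \<in> I"
    then show "(a j *\<^sub>R v j) \<bullet> w = (if j = i then a i else 0)"
      using w[of j] supp[of j] by (cases "a j = 0") auto
  qed simp
  also have "\<dots> = a i"
    using assms(2) i by simp
  finally show False using ai by simp
qed

section \<open>Derivatives along lines and curves\<close>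

lemma GDERIV_line:
  fixes f :: "'a::real_inner \<Rightarrow> real"
  assumes "GDERIV f p :> g"
  shows "((\<lambda>t. f (p + t *\<^sub>R d)) has_real_derivative d \<bullet> g) (at 0 within S)"
proof -
  have "(f has_derivative (\<lambda>h. h \<bullet> g)) (at (p + 0 *\<^sub>R d))"
    using assms by (simp add: gderiv_def)
  then have "((\<lambda>t. f (p + t *\<^sub>R d)) has_derivative (\<lambda>t. (t *\<^sub>R d) \<bullet> g)) (at 0 within S)"
    by (rule has_derivative_compose[rotated]) (auto intro!: derivative_eq_intros)
  then show ?thesis
    by (simp add: has_field_derivative_def mult_commute_abs)
qed

lemma twice_cont_diff_GDERIV: "twice_cont_diff f \<Longrightarrow> GDERIV f y :> gradient f y"
  by (metis gradient_eqI twice_cont_diff_def)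

text \<open>Restriction to the line through \<open>p\<close> and \<open>y\<close> reduces this to
  the tangent inequality in one variable.\<close>

lemma convex_on_ge_gradient:
  fixes f :: "'a::real_inner \<Rightarrow> real"
  assumes conv: "convex_on UNIV f" and g: "GDERIV f p :> g"
  shows "f p + (y - p) \<bullet> g \<le> f y"
proof -
  have "convex_on UNIV (\<lambda>t. f (p + t *\<^sub>R (y - p)))"
  proof (rule convex_onI)
    fix t r s :: real assume "0 < t" "t < 1"
    then have "f ((1 - t) *\<^sub>R (p + r *\<^sub>R (y - p)) + t *\<^sub>R (p + s *\<^sub>R (y - p)))
        \<le> (1 - t) * f (p + r *\<^sub>R (y - p)) + t * f (p + s *\<^sub>R (y - p))"
      by (intro convex_onD[OF conv]) auto
    moreover have "(1 - t) *\<^sub>R (p + r *\<^sub>R (y - p)) + t *\<^sub>R (p + s *\<^sub>R (y - p))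
        = p + ((1 - t) *\<^sub>R r + t *\<^sub>R s) *\<^sub>R (y - p)"
      by (simp add: algebra_simps)
    ultimately show "f (p + ((1 - t) *\<^sub>R r + t *\<^sub>R s) *\<^sub>R (y - p))
        \<le> (1 - t) * f (p + r *\<^sub>R (y - p)) + t * f (p + s *\<^sub>R (y - p))"
      by simp
  qed simp
  then have "f (p + 1 *\<^sub>R (y - p)) - f (p + 0 *\<^sub>R (y - p)) \<ge> ((y - p) \<bullet> g) * (1 - 0)"
    by (rule convex_on_imp_above_tangent) (auto intro: GDERIV_line g)
  then show ?thesis by simp
qed

text \<open>For small \<open>t > 0\<close> active constraints fall below 0 because of their negative
  slope and inactive ones stay negative by continuity, so a negative \<open>D\<close> would give
  better feasible points nearby. Right derivatives suffice, which admits curves containing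
  \<open>sqrt t\<close>.\<close>

lemma local_minimizer_no_descent_curve:
  fixes \<gamma> :: "real \<Rightarrow> 'a::metric_space"
  assumes min: "local_minimizer F {q. \<forall>j\<in>J. G j q \<le> 0} (\<gamma> 0)" and "finite J"
    and lim: "(\<gamma> \<longlongrightarrow> \<gamma> 0) (at_right 0)"
    and F: "((\<lambda>t. F (\<gamma> t)) has_real_derivative D) (at_right 0)"
    and G: "\<And>j. j \<in> J \<Longrightarrow> ((\<lambda>t. G j (\<gamma> t)) has_real_derivative E j) (at_right 0)"
    and active: "\<And>j. j \<in> J \<Longrightarrow> G j (\<gamma> 0) = 0 \<Longrightarrow> E j < 0"
  shows "0 \<le> D"
proof (rule ccontr)
  have dec: "\<forall>\<^sub>F t in at_right 0. h t < h 0"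
    if "(h has_real_derivative l) (at_right 0)" "l < 0" for h :: "real \<Rightarrow> real" and l
    using has_real_derivative_neg_dec_right[OF that]
    by (force simp: eventually_at_right_field)
  obtain e where e: "e > 0"
    "\<And>q. \<forall>j\<in>J. G j q \<le> 0 \<Longrightarrow> dist (\<gamma> 0) q < e \<Longrightarrow> F (\<gamma> 0) \<le> F q"
    using min by (auto simp: local_minimizer_def)
  assume "\<not> 0 \<le> D"
  then have "\<forall>\<^sub>F t in at_right 0. F (\<gamma> t) < F (\<gamma> 0)"
    by (intro dec[OF F]) simp
  moreover have "\<forall>\<^sub>F t in at_right 0. \<forall>j\<in>J. G j (\<gamma> t) \<le> 0"
  proof (intro eventually_ball_finite \<open>finite J\<close> ballI)
    fix j assume j: "j \<in> J"
    then have "G j (\<gamma> 0) \<le> 0"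
      using min by (auto simp: local_minimizer_def)
    then consider "G j (\<gamma> 0) = 0" | "G j (\<gamma> 0) < 0" by linarith
    then show "\<forall>\<^sub>F t in at_right 0. G j (\<gamma> t) \<le> 0"
    proof cases
      case 1
      then show ?thesis
        using dec[OF G[OF j] active[OF j 1]] by (auto elim: eventually_mono)
    next
      case 2
      have "((\<lambda>t. G j (\<gamma> t)) \<longlongrightarrow> G j (\<gamma> 0)) (at_right 0)"
        using DERIV_continuous[OF G[OF j]] by (simp add: continuous_within)
      from order_tendstoD(2)[OF this 2] show ?thesis
        by (auto elim: eventually_mono)
    qed
  qed
  moreover have "\<forall>\<^sub>F t in at_right 0. dist (\<gamma> t) (\<gamma> 0) < e"
    using lim e(1) by (rule tendstoD)
  ultimately have "\<forall>\<^sub>F t::real in at_right 0. False"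
    by eventually_elim (metis e(2) dist_commute not_le)
  then show False by simp
qed

lemma nonneg_of_perturbation:
  fixes a b c :: real
  assumes "\<And>e. e > 0 \<Longrightarrow> 0 \<le> a + b * e + c * e\<^sup>2"
  shows "0 \<le> a"
proof (rule tendsto_lowerbound)
  show "((\<lambda>e. a + b * e + c * e\<^sup>2) \<longlongrightarrow> a) (at_right 0)"
    by (auto intro!: tendsto_eq_intros)
  show "\<forall>\<^sub>F e in at_right 0. 0 \<le> a + b * e + c * e\<^sup>2"
    using eventually_at_right_less[of "0::real"] by eventually_elim (use assms in auto)
qed simp

section \<open>First-order conditions for the quadratic problem\<close>

lemma shifted_matrix_vector: "(A + m *\<^sub>R mat 1) *v x = A *v x + m *\<^sub>R (x :: real^'n)"
  by (simp add: matrix_vector_mult_add_rdistrib flip: scaleR_matrix_vector_assoc)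

lemma quadratic_expand:
  fixes H :: "real^'n^'n"
  assumes "transpose H = H"
  shows "1/2 * ((x + u) \<bullet> (H *v (x + u))) + c \<bullet> (x + u) =
    1/2 * (x \<bullet> (H *v x)) + c \<bullet> x + (H *v x + c) \<bullet> u + 1/2 * (u \<bullet> (H *v u))"
  using symmetric_matrix_inner[OF assms, of u x] symmetric_matrix_inner[OF assms, of x u]
  by (simp add: matrix_vector_right_distrib inner_add_left inner_add_right inner_commute)

text \<open>Puts the ball constraint, at index 1, and the remaining ones into a single family, so
  that descent curves can treat them uniformly.\<close>

definition constr :: "(nat \<Rightarrow> real^'m \<Rightarrow> real) \<Rightarrow> nat \<Rightarrow> (real^'n) \<times> (real^'m) \<Rightarrow> real" where
  "constr f j = (\<lambda>(x, y). (if j = 1 then x \<bullet> x else 0) + f j y)"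

lemma feasible_set_constr:
  assumes "k \<ge> 1"
  shows "feasible_set k f = {q. \<forall>j\<in>{1..k}. constr f j q \<le> 0}"
proof -
  have "{1..k} = insert 1 {2..k}" using assms by auto
  then show ?thesis by (auto simp: feasible_set_def constr_def)
qed

locale local_min =
  fixes H :: "real^'n^'n" and c xs :: "real^'n" and ys :: "real^'m"
    and f :: "nat \<Rightarrow> real^'m \<Rightarrow> real" and g :: "nat \<Rightarrow> real^'m" and k :: nat
  assumes k_ge_1: "k \<ge> 1" and sym: "transpose H = H"
    and grad: "\<And>j. j \<le> k \<Longrightarrow> GDERIV (f j) ys :> g j"
    and min: "local_minimizer (objective H c f) (feasible_set k f) (xs, ys)"
begin

lemma feasible: "xs \<bullet> xs + f 1 ys \<le> 0" "j \<in> {2..k} \<Longrightarrow> f j ys \<le> 0"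
  using min by (auto simp: local_minimizer_def feasible_set_def)

text \<open>Keeping \<open>y = ys\<close> preserves all constraints except the ball constraint, and
  the change of the objective is then an exact quadratic in \<open>u\<close>.\<close>

lemma quadratic_local_min:
  obtains e where "e > 0"
    "\<And>u. norm u < e \<Longrightarrow> (xs + u) \<bullet> (xs + u) + f 1 ys \<le> 0 \<Longrightarrow>
      0 \<le> (H *v xs + c) \<bullet> u + 1/2 * (u \<bullet> (H *v u))"
proof -
  obtain e where e: "e > 0"
    "\<And>q. q \<in> feasible_set k f \<Longrightarrow> dist (xs, ys) q < e \<Longrightarrow>
      objective H c f (xs, ys) \<le> objective H c f q"
    using min by (auto simp: local_minimizer_def)
  have "0 \<le> (H *v xs + c) \<bullet> u + 1/2 * (u \<bullet> (H *v u))"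
    if u: "norm u < e" "(xs + u) \<bullet> (xs + u) + f 1 ys \<le> 0" for u
  proof -
    have "(xs + u, ys) \<in> feasible_set k f"
      using u(2) feasible(2) by (auto simp: feasible_set_def)
    moreover have "dist (xs, ys) (xs + u, ys) < e"
      using u(1) by (simp add: dist_Pair_Pair dist_norm)
    ultimately have "objective H c f (xs, ys) \<le> objective H c f (xs + u, ys)"
      by (rule e(2))
    then show ?thesis
      using quadratic_expand[OF sym, of xs u c] by (simp add: objective_def)
  qed
  then show ?thesis using that e(1) by blast
qed

text \<open>With slack in the ball constraint, short steps along both \<open>u\<close> and
  \<open>- u\<close> are feasible. Adding the two inequalities cancels the linear term and leaves
  the form of \<open>H\<close>, which would be nonnegative everywhere.\<close>

lemma ball_constraint_active:
  assumes "\<not> pos_semidef H"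
  shows "xs \<bullet> xs + f 1 ys = 0"
proof (rule ccontr)
  assume "xs \<bullet> xs + f 1 ys \<noteq> 0"
  with feasible(1) have neg: "xs \<bullet> xs + f 1 ys < 0" by simp
  obtain e where e: "e > 0"
    "\<And>u. norm u < e \<Longrightarrow> (xs + u) \<bullet> (xs + u) + f 1 ys \<le> 0 \<Longrightarrow>
      0 \<le> (H *v xs + c) \<bullet> u + 1/2 * (u \<bullet> (H *v u))"
    using quadratic_local_min by blast
  have "0 \<le> u \<bullet> (H *v u)" for u
  proof -
    have ev: "\<forall>\<^sub>F t in at_right (0::real). norm (t *\<^sub>R v) < e \<and> (xs + t *\<^sub>R v) \<bullet> (xs + t *\<^sub>R v) + f 1 ys < 0"
      for v
    proof (intro eventually_conj)
      have "((\<lambda>t. norm (t *\<^sub>R v)) \<longlongrightarrow> norm (0 *\<^sub>R v)) (at_right (0::real))"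
        by (intro tendsto_intros)
      then show "\<forall>\<^sub>F t in at_right (0::real). norm (t *\<^sub>R v) < e"
        by (rule order_tendstoD(2)) (use e in simp)
      have "((\<lambda>t. (xs + t *\<^sub>R v) \<bullet> (xs + t *\<^sub>R v) + f 1 ys) \<longlongrightarrow>
          (xs + 0 *\<^sub>R v) \<bullet> (xs + 0 *\<^sub>R v) + f 1 ys) (at_right (0::real))"
        by (intro tendsto_intros)
      then show "\<forall>\<^sub>F t in at_right (0::real). (xs + t *\<^sub>R v) \<bullet> (xs + t *\<^sub>R v) + f 1 ys < 0"
        by (rule order_tendstoD(2)) (use neg in simp)
    qed
    have "\<forall>\<^sub>F t in at_right (0::real). 0 \<le> u \<bullet> (H *v u)"
      using ev[of u] ev[of "- u"] eventually_at_right_less[of "0::real"]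
    proof eventually_elim
      case (elim t)
      define w where "w = t *\<^sub>R u"
      have "0 \<le> (H *v xs + c) \<bullet> w + 1/2 * (w \<bullet> (H *v w))"
        using elim by (intro e(2)) (auto simp: w_def)
      moreover have "0 \<le> (H *v xs + c) \<bullet> (- w) + 1/2 * ((- w) \<bullet> (H *v (- w)))"
        using elim by (intro e(2)) (auto simp: w_def)
      moreover have "H *v (- w) = - (H *v w)"
        by (metis matrix_vector_mult_scaleR scaleR_minus1_left)
      ultimately have "0 \<le> w \<bullet> (H *v w)"
        by simp
      then have "0 \<le> t\<^sup>2 * (u \<bullet> (H *v u))"
        by (simp add: w_def matrix_vector_mult_scaleR power2_eq_square)
      with elim show ?case by (simp add: zero_le_mult_iff)
    qed
    then show ?thesis by simp
  qed
  with assms sym show False by (simp add: pos_semidef_def)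
qed

text \<open>No direction decreases the objective and all active constraints to first order, so
  Gordan's alternative yields weights on their gradients. Independence forces a positive weight on
  the objective, by which the relation is divided.\<close>

lemma kkt:
  assumes act: "xs \<bullet> xs + f 1 ys = 0"
    and licq: "lin_indep_family g {j \<in> {1..k}. f j ys = 0}"
  obtains mu where "\<And>j. 0 \<le> mu j" "(H + mu 1 *\<^sub>R mat 1) *v xs + c = 0"
    "g 0 + (mu 1 / 2) *\<^sub>R g 1 + (\<Sum>j = 2..k. mu j *\<^sub>R g j) = 0"
    "\<And>j. j \<in> {2..k} \<Longrightarrow> mu j * f j ys = 0"
proof -
  define I where "I = {j \<in> {1..k}. constr f j (xs, ys) = 0}"
  have I: "finite I" "1 \<in> I" "0 \<notin> I" "I \<subseteq> {1..k}"
    using act k_ge_1 by (auto simp: I_def constr_def)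
  \<comment> \<open>The joint gradients in \<open>(x, y)\<close>; index 0 is the objective.\<close>
  define v where "v j = ((if j = 0 then H *v xs + c else if j = 1 then 2 *\<^sub>R xs else 0), g j)" for j
  have "\<exists>i\<in>insert 0 I. 0 \<le> v i \<bullet> d" for d
  proof (rule ccontr)
    assume "\<not> (\<exists>i\<in>insert 0 I. 0 \<le> v i \<bullet> d)"
    then have neg: "v 0 \<bullet> d < 0" "\<And>i. i \<in> I \<Longrightarrow> v i \<bullet> d < 0" by force+
    obtain a b where d: "d = (a, b)" by fastforce
    let ?p = "\<lambda>t. (xs + t *\<^sub>R a, ys + t *\<^sub>R b)"
    have "0 \<le> v 0 \<bullet> d"
    proof (rule local_minimizer_no_descent_curve)
      show "local_minimizer (objective H c f) {q. \<forall>j\<in>{1..k}. constr f j q \<le> 0} (?p 0)"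
        using min by (simp add: feasible_set_constr[OF k_ge_1])
      show "(?p \<longlongrightarrow> ?p 0) (at_right 0)"
        by (intro tendsto_intros)
      have "objective H c f (?p t) = (1/2 * (xs \<bullet> (H *v xs)) + c \<bullet> xs) + t * ((H *v xs + c) \<bullet> a)
          + t\<^sup>2 * (1/2 * (a \<bullet> (H *v a))) + f 0 (ys + t *\<^sub>R b)" for t
        using quadratic_expand[OF sym, of xs "t *\<^sub>R a" c]
        by (simp add: objective_def matrix_vector_mult_scaleR power2_eq_square)
      moreover have "((\<lambda>t. (1/2 * (xs \<bullet> (H *v xs)) + c \<bullet> xs) + t * ((H *v xs + c) \<bullet> a)
          + t\<^sup>2 * (1/2 * (a \<bullet> (H *v a))) + f 0 (ys + t *\<^sub>R b))
          has_real_derivative v 0 \<bullet> d) (at_right 0)"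
        by (rule derivative_eq_intros GDERIV_line grad refl le0)+
          (simp add: v_def d inner_commute)
      ultimately show "((\<lambda>t. objective H c f (?p t)) has_real_derivative v 0 \<bullet> d) (at_right 0)"
        by simp
      fix j assume j: "j \<in> {1..k}"
      have "constr f j (?p t) = (if j = 1 then xs \<bullet> xs + t * (2 * (xs \<bullet> a)) + t\<^sup>2 * (a \<bullet> a) else 0)
          + f j (ys + t *\<^sub>R b)" for t
        by (simp add: constr_def inner_add_left inner_add_right inner_commute power2_eq_square)
      moreover have "((\<lambda>t. if j = 1 then xs \<bullet> xs + t * (2 * (xs \<bullet> a)) + t\<^sup>2 * (a \<bullet> a) else 0)
          has_real_derivative (if j = 1 then 2 * (xs \<bullet> a) else 0)) (at_right 0)"
        by (cases "j = 1") (auto intro!: derivative_eq_intros)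
      from DERIV_add[OF this GDERIV_line[OF grad]] j
      have "((\<lambda>t. (if j = 1 then xs \<bullet> xs + t * (2 * (xs \<bullet> a)) + t\<^sup>2 * (a \<bullet> a) else 0)
          + f j (ys + t *\<^sub>R b)) has_real_derivative v j \<bullet> d) (at_right 0)"
        by (auto simp: v_def d inner_commute)
      ultimately show "((\<lambda>t. constr f j (?p t)) has_real_derivative v j \<bullet> d) (at_right 0)"
        by simp
      show "v j \<bullet> d < 0" if "constr f j (?p 0) = 0"
        using that j by (intro neg) (simp add: I_def)
    qed simp
    with neg(1) show False by simp
  qed
  then obtain a where a: "\<And>i. i \<in> insert 0 I \<Longrightarrow> 0 \<le> a i" "sum a (insert 0 I) = 1"
    "(\<Sum>i\<in>insert 0 I. a i *\<^sub>R v i) = 0"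
    using gordan_alternative[of "insert 0 I" v] I(1) by blast
  have fst0: "a 0 *\<^sub>R (H *v xs + c) + (2 * a 1) *\<^sub>R xs = 0"
  proof -
    have "(\<Sum>i\<in>I. a i *\<^sub>R (if i = 0 then H *v xs + c else if i = 1 then 2 *\<^sub>R xs else 0)) =
        (\<Sum>i\<in>I. if i = 1 then (2 * a 1) *\<^sub>R xs else 0)"
      using I(3) by (intro sum.cong) auto
    then show ?thesis
      using arg_cong[OF a(3), of fst] I by (simp add: fst_sum v_def)
  qed
  have snd0: "a 0 *\<^sub>R g 0 + (\<Sum>i\<in>I. a i *\<^sub>R g i) = 0"
    using arg_cong[OF a(3), of snd] I by (simp add: snd_sum v_def)
  have "a 0 \<noteq> 0"
  proof
    assume a0: "a 0 = 0"
    have "a i = 0" if "i \<in> I" for i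
    proof (rule lin_indep_family_sum_eq_0[OF licq I(1) _ _ that])
      show "(\<Sum>i\<in>I. a i *\<^sub>R g i) = 0" using snd0 a0 by simp
      fix i assume i: "i \<in> I" "a i \<noteq> 0"
      \<comment> \<open>Membership of 1 in \<open>I\<close> does not say that
        \<open>f 1 ys = 0\<close>. But a nonzero \<open>a 1\<close> together with
        \<open>a 0 = 0\<close> forces \<open>xs = 0\<close> in the first component, and then
        activity of the ball constraint gives it.\<close>
      show "i \<in> {j \<in> {1..k}. f j ys = 0}"
      proof (cases "i = 1")
        case True
        then have "xs = 0" using fst0 a0 i by simp
        then show ?thesis using act True k_ge_1 by simp
      next
        case False
        then show ?thesis using i by (simp add: I_def constr_def)
      qed
    qed
    then show False using a(2) a0 I by simp
  qed
  with a(1)[of 0] have a0: "a 0 > 0" by simp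
  \<comment> \<open>The gradient of \<open>x \<bullet> x\<close> is twice \<open>x\<close>;
    absorbing this 2 into \<open>mu 1\<close> is what puts \<open>mu 1 / 2\<close> in front of
    \<open>g 1\<close>. The value 0 off \<open>I\<close> gives complementarity.\<close>
  define mu where "mu j = (if j \<in> I then (if j = 1 then 2 else 1) * a j / a 0 else 0)" for j
  show ?thesis
  proof
    show "0 \<le> mu j" for j
      using a(1) a0 by (auto simp: mu_def)
    have "(1 / a 0) *\<^sub>R (a 0 *\<^sub>R (H *v xs + c) + (2 * a 1) *\<^sub>R xs) = 0"
      by (simp only: fst0 scaleR_zero_right)
    then show "(H + mu 1 *\<^sub>R mat 1) *v xs + c = 0"
      using a0 I(2) unfolding shifted_matrix_vector by (simp add: mu_def algebra_simps)
    show "mu j * f j ys = 0" if "j \<in> {2..k}" for j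
      using that by (auto simp: mu_def I_def constr_def)
    have "(\<Sum>i\<in>I. a i *\<^sub>R g i) = a 1 *\<^sub>R g 1 + (\<Sum>i\<in>I - {1}. a i *\<^sub>R g i)"
      using I by (simp add: sum.remove)
    also have "(\<Sum>i\<in>I - {1}. a i *\<^sub>R g i) = (\<Sum>i\<in>I - {1}. (a 0 * mu i) *\<^sub>R g i)"
      using a0 by (intro sum.cong) (auto simp: mu_def)
    also have "\<dots> = (\<Sum>i=2..k. (a 0 * mu i) *\<^sub>R g i)"
    proof (rule sum.mono_neutral_left)
      show "I - {1} \<subseteq> {2..k}" using I(4) by force
    qed (auto simp: mu_def)
    finally have "a 0 *\<^sub>R (g 0 + (mu 1 / 2) *\<^sub>R g 1 + (\<Sum>j = 2..k. mu j *\<^sub>R g j)) = 0"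
      using snd0 a0 I(2) by (simp add: mu_def scaleR_right_distrib scaleR_sum_right add.assoc)
    then show "g 0 + (mu 1 / 2) *\<^sub>R g 1 + (\<Sum>j = 2..k. mu j *\<^sub>R g j) = 0"
      using a0 by simp
  qed
qed

end

section \<open>Second-order conditions\<close>

locale kkt_point = local_min +
  fixes mu :: "nat \<Rightarrow> real"
  assumes active: "xs \<bullet> xs + f 1 ys = 0"
    and mu_nonneg: "\<And>j. 0 \<le> mu j"
    and stat_x: "(H + mu 1 *\<^sub>R mat 1) *v xs + c = 0"
    and stat_y: "g 0 + (mu 1 / 2) *\<^sub>R g 1 + (\<Sum>j = 2..k. mu j *\<^sub>R g j) = 0"
    and compl: "\<And>j. j \<in> {2..k} \<Longrightarrow> mu j * f j ys = 0"
begin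

text \<open>The Hessian in \<open>x\<close> of the Lagrangian, where the ball constraint has weight
  \<open>mu 1 / 2\<close>.\<close>

definition A where "A = H + mu 1 *\<^sub>R mat 1"

lemma A_apply: "A *v x = H *v x + mu 1 *\<^sub>R x"
  by (simp add: A_def shifted_matrix_vector)

lemma A_sym: "transpose A = A"
  using sym by (auto simp: A_def vec_eq_iff transpose_def mat_def)

lemma grad_quadratic: "H *v xs + c = - (mu 1 *\<^sub>R xs)"
  using stat_x unfolding shifted_matrix_vector by (simp add: algebra_simps eq_neg_iff_add_eq_0)

lemma inner_g_0: "w \<bullet> g 0 = - (mu 1 / 2 * (w \<bullet> g 1)) - (\<Sum>j = 2..k. mu j * (w \<bullet> g j))"
proof -
  have "w \<bullet> (g 0 + (mu 1 / 2) *\<^sub>R g 1 + (\<Sum>j = 2..k. mu j *\<^sub>R g j)) = 0"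
    by (simp only: stat_y inner_zero_right)
  then show ?thesis
    by (simp add: inner_add_right inner_sum_right)
qed

text \<open>The chord \<open>t *\<^sub>R w\<close> with \<open>t = - 2 (w \<bullet> xs) / (w \<bullet> w)\<close> leads from \<open>xs\<close> to another point of the
  same sphere, and it is short when \<open>w\<close> is almost tangent.\<close>

lemma near_tangent_nonneg:
  assumes w: "w \<noteq> 0" "w \<bullet> xs = 0" and z: "z \<bullet> xs \<noteq> 0"
  shows "\<forall>\<^sub>F t in at 0. 0 \<le> (w + t *\<^sub>R z) \<bullet> (A *v (w + t *\<^sub>R z))"
proof -
  obtain e where e: "e > 0"
    "\<And>u. norm u < e \<Longrightarrow> (xs + u) \<bullet> (xs + u) + f 1 ys \<le> 0 \<Longrightarrow>
      0 \<le> (H *v xs + c) \<bullet> u + 1/2 * (u \<bullet> (H *v u))"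
    using quadratic_local_min by blast
  have chord: "0 \<le> v \<bullet> (A *v v)" if v: "v \<bullet> xs \<noteq> 0" "2 * \<bar>v \<bullet> xs\<bar> < e * norm v" for v
  proof -
    have v0: "v \<noteq> 0" using v(1) by auto
    define t where "t = - 2 * (v \<bullet> xs) / (v \<bullet> v)"
    have t0: "t \<noteq> 0" and tvv: "t * (v \<bullet> v) = - 2 * (v \<bullet> xs)"
      using v v0 by (auto simp: t_def)
    have sphere: "2 * (xs \<bullet> (t *\<^sub>R v)) + (t *\<^sub>R v) \<bullet> (t *\<^sub>R v) = 0"
      using tvv by (simp add: inner_commute)
    have "norm (t *\<^sub>R v) * norm v = 2 * \<bar>v \<bullet> xs\<bar>"
      using v0 by (simp add: t_def abs_mult flip: power2_norm_eq_inner)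
        (simp add: power2_eq_square)
    with v(2) have "norm (t *\<^sub>R v) * norm v < e * norm v" by simp
    then have "norm (t *\<^sub>R v) < e" using v0 by (simp only: mult_less_cancel_right) auto
    moreover have "(xs + t *\<^sub>R v) \<bullet> (xs + t *\<^sub>R v) + f 1 ys \<le> 0"
    proof -
      have "(xs + t *\<^sub>R v) \<bullet> (xs + t *\<^sub>R v) =
          xs \<bullet> xs + (2 * (xs \<bullet> (t *\<^sub>R v)) + (t *\<^sub>R v) \<bullet> (t *\<^sub>R v))"
        by (simp add: inner_add_left inner_add_right inner_commute)
      then show ?thesis using sphere active by simp
    qed
    ultimately have "0 \<le> (H *v xs + c) \<bullet> (t *\<^sub>R v) + 1/2 * ((t *\<^sub>R v) \<bullet> (H *v (t *\<^sub>R v)))"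
      by (rule e(2))
    \<comment> \<open>Stationarity turns the linear term into a multiple of \<open>xs\<close>; on
      the sphere it equals exactly the part by which the form of \<open>A\<close> exceeds that of
      \<open>H\<close>.\<close>
    also have "\<dots> = 1/2 * ((t *\<^sub>R v) \<bullet> (A *v (t *\<^sub>R v)))
        - mu 1 / 2 * (2 * (xs \<bullet> (t *\<^sub>R v)) + (t *\<^sub>R v) \<bullet> (t *\<^sub>R v))"
      by (simp only: grad_quadratic A_apply inner_add_right inner_minus_left inner_scaleR_left
          inner_scaleR_right) (simp add: algebra_simps)
    also have "\<dots> = 1/2 * t\<^sup>2 * (v \<bullet> (A *v v))"
      by (simp only: sphere) (simp add: matrix_vector_mult_scaleR power2_eq_square)
    finally show ?thesis using t0 by (simp add: zero_le_mult_iff)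
  qed
  have "((\<lambda>t. 2 * \<bar>(w + t *\<^sub>R z) \<bullet> xs\<bar> - e * norm (w + t *\<^sub>R z)) \<longlongrightarrow>
      2 * \<bar>(w + 0 *\<^sub>R z) \<bullet> xs\<bar> - e * norm (w + 0 *\<^sub>R z)) (at 0)"
    by (intro tendsto_intros)
  then have "\<forall>\<^sub>F t in at 0. 2 * \<bar>(w + t *\<^sub>R z) \<bullet> xs\<bar> - e * norm (w + t *\<^sub>R z) < 0"
    by (rule order_tendstoD(2)) (use w e(1) in simp)
  moreover have "\<forall>\<^sub>F t in at (0::real). t \<noteq> 0"
    by (rule eventually_neq_at_within)
  ultimately show ?thesis
  proof eventually_elim
    case (elim t)
    then have "(w + t *\<^sub>R z) \<bullet> xs \<noteq> 0"
      using w z by (simp add: inner_add_left)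
    with elim show ?case by (intro chord) auto
  qed
qed

text \<open>The Lagrangian is convex here. Gradient inequalities for the \<open>f j\<close>,
  weighted by the multipliers, bound the increase of the objective below by half of
  \<open>u \<bullet> (A *v u)\<close>.\<close>

lemma global_of_nonneg:
  assumes conv: "\<And>j. j \<le> k \<Longrightarrow> convex_on UNIV (f j)" and nonneg: "\<And>u. 0 \<le> u \<bullet> (A *v u)"
  shows "global_minimizer (objective H c f) (feasible_set k f) (xs, ys)"
proof -
  have "objective H c f (xs, ys) \<le> objective H c f (x, y)" if feas: "(x, y) \<in> feasible_set k f" for x y
  proof -
    define u where "u = x - xs"
    define w where "w = y - ys"
    have f_ge: "f j ys + w \<bullet> g j \<le> f j y" if "j \<le> k" for j
      using convex_on_ge_gradient[OF conv grad] that by (simp add: w_def)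
    have "mu j * (w \<bullet> g j) \<le> 0" if j: "j \<in> {2..k}" for j
    proof -
      have "f j y \<le> 0" using feas j by (auto simp: feasible_set_def)
      with f_ge[of j] j have "f j ys + w \<bullet> g j \<le> 0" by auto
      then have "mu j * (f j ys + w \<bullet> g j) \<le> 0"
        using mu_nonneg[of j] by (simp add: mult_nonneg_nonpos)
      then show ?thesis using compl[OF j] by (simp add: distrib_left)
    qed
    then have sum_le: "(\<Sum>j = 2..k. mu j * (w \<bullet> g j)) \<le> 0"
      by (rule sum_nonpos)
    have "2 * (xs \<bullet> u) + u \<bullet> u + w \<bullet> g 1 \<le> 0"
    proof -
      have "(xs + u) \<bullet> (xs + u) + f 1 y \<le> 0"
        using feas by (simp add: feasible_set_def u_def)
      then have "xs \<bullet> xs + (2 * (xs \<bullet> u) + u \<bullet> u) + f 1 y \<le> 0"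
        by (simp add: inner_add_left inner_add_right inner_commute)
      with active f_ge[of 1] k_ge_1 show ?thesis by simp
    qed
    then have "mu 1 / 2 * (2 * (xs \<bullet> u) + u \<bullet> u + w \<bullet> g 1) \<le> 0"
      using mu_nonneg[of 1] by (simp add: mult_nonneg_nonpos)
    then have ball: "mu 1 * (xs \<bullet> u) + 1/2 * (mu 1 * (u \<bullet> u)) + mu 1 / 2 * (w \<bullet> g 1) \<le> 0"
      by (simp add: algebra_simps)
    have "objective H c f (x, y) - objective H c f (xs, ys)
        = (H *v xs + c) \<bullet> u + 1/2 * (u \<bullet> (H *v u)) + (f 0 y - f 0 ys)"
      using quadratic_expand[OF sym, of xs u c] by (simp add: objective_def u_def)
    also have "(H *v xs + c) \<bullet> u = - (mu 1 * (xs \<bullet> u))"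
      by (simp add: grad_quadratic)
    finally have obj: "objective H c f (x, y) - objective H c f (xs, ys)
        = - (mu 1 * (xs \<bullet> u)) + 1/2 * (u \<bullet> (H *v u)) + (f 0 y - f 0 ys)" .
    have "u \<bullet> (A *v u) = u \<bullet> (H *v u) + mu 1 * (u \<bullet> u)"
      by (simp add: A_apply inner_add_right)
    with nonneg[of u] obj ball sum_le f_ge[of 0] inner_g_0[of w]
    show ?thesis by linarith
  qed
  then show ?thesis
    using min by (auto simp: global_minimizer_def local_minimizer_def)
qed

text \<open>At \<open>xs = 0\<close> the ball constraint degenerates. The curve \<open>(sqrt t u, ys + t w)\<close> makes the
  quadratic terms in \<open>u\<close> enter at first order in \<open>t\<close>, and independence of the gradients supplies a
  \<open>w\<close> compensating them in all active constraints.\<close>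

lemma nonneg_at_origin:
  assumes licq: "lin_indep_family g {j \<in> {1..k}. f j ys = 0}" and xs: "xs = 0"
  shows "0 \<le> u \<bullet> (A *v u)"
proof -
  have c0: "c = 0" using grad_quadratic xs by simp
  have f1: "f 1 ys = 0" using active xs by simp
  have "0 \<le> (u \<bullet> (A *v u)) + (mu 1 + 2 * (\<Sum>j = 2..k. mu j)) * e + 0 * e\<^sup>2" if e: "e > 0" for e
  proof -
    \<comment> \<open>With this \<open>w\<close> every active constraint has slope
      \<open>- e\<close> along the curve; letting \<open>e\<close> tend to 0 removes the error
      afterwards.\<close>
    obtain w where w: "\<And>j. j \<in> {j \<in> {1..k}. f j ys = 0} \<Longrightarrow>
        g j \<bullet> w = - e - (if j = 1 then u \<bullet> u else 0)"
      using lin_indep_family_dual[OF licq, where b = "\<lambda>j. - e - (if j = 1 then u \<bullet> u else 0)"]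
      by auto
    let ?p = "\<lambda>t. (sqrt t *\<^sub>R u, ys + t *\<^sub>R w)"
    have "0 \<le> 1/2 * (u \<bullet> (H *v u)) + w \<bullet> g 0"
    proof (rule local_minimizer_no_descent_curve)
      show "local_minimizer (objective H c f) {q. \<forall>j\<in>{1..k}. constr f j q \<le> 0} (?p 0)"
        using min xs by (simp add: feasible_set_constr[OF k_ge_1])
      show "(?p \<longlongrightarrow> ?p 0) (at_right 0)"
        by (intro tendsto_intros)
      \<comment> \<open>This fails for negative \<open>t\<close>, where \<open>sqrt\<close> is
        extended as an odd function; hence derivatives within \<open>{0..}\<close>.\<close>
      have root: "sqrt t * (sqrt t * r) = t * r" if "t \<ge> 0" for t r
        using that by (simp flip: mult.assoc)
      have "((\<lambda>t. t * (1/2 * (u \<bullet> (H *v u))) + f 0 (ys + t *\<^sub>R w))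
          has_real_derivative (1/2 * (u \<bullet> (H *v u)) + w \<bullet> g 0)) (at 0 within {0..})"
        by (rule derivative_eq_intros GDERIV_line grad refl le0)+ simp
      then have "((\<lambda>t. objective H c f (?p t))
          has_real_derivative (1/2 * (u \<bullet> (H *v u)) + w \<bullet> g 0)) (at 0 within {0..})"
        by (rule has_field_derivative_transform_within[where d = 1])
          (auto simp: objective_def c0 matrix_vector_mult_scaleR root)
      then show "((\<lambda>t. objective H c f (?p t))
          has_real_derivative (1/2 * (u \<bullet> (H *v u)) + w \<bullet> g 0)) (at_right 0)"
        by (rule DERIV_subset) auto
      fix j assume j: "j \<in> {1..k}"
      have "((\<lambda>t. t * (if j = 1 then u \<bullet> u else 0) + f j (ys + t *\<^sub>R w))
          has_real_derivative ((if j = 1 then u \<bullet> u else 0) + w \<bullet> g j)) (at 0 within {0..})"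
        by (rule derivative_eq_intros GDERIV_line grad refl)+ (use j in auto)
      then have "((\<lambda>t. constr f j (?p t))
          has_real_derivative ((if j = 1 then u \<bullet> u else 0) + w \<bullet> g j)) (at 0 within {0..})"
        by (rule has_field_derivative_transform_within[where d = 1])
          (auto simp: constr_def root)
      then show "((\<lambda>t. constr f j (?p t))
          has_real_derivative ((if j = 1 then u \<bullet> u else 0) + w \<bullet> g j)) (at_right 0)"
        by (rule DERIV_subset) auto
      show "(if j = 1 then u \<bullet> u else 0) + w \<bullet> g j < 0" if "constr f j (?p 0) = 0"
      proof -
        have "f j ys = 0" using that by (auto simp: constr_def split: if_splits)
        with w[of j] j e show ?thesis by (simp add: inner_commute)
      qed
    qed simp
    moreover have "w \<bullet> g 0 = mu 1 / 2 * (e + u \<bullet> u) + (\<Sum>j = 2..k. mu j) * e"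
    proof -
      have w1: "w \<bullet> g 1 = - (e + u \<bullet> u)"
        using w[of 1] f1 k_ge_1 by (simp add: inner_commute)
      have "(\<Sum>j = 2..k. mu j * (w \<bullet> g j)) = (\<Sum>j = 2..k. - (mu j * e))"
      proof (rule sum.cong)
        fix j assume j: "j \<in> {2..k}"
        show "mu j * (w \<bullet> g j) = - (mu j * e)"
          using w[of j] compl[OF j] j by (cases "f j ys = 0") (auto simp: inner_commute)
      qed simp
      also have "\<dots> = - ((\<Sum>j = 2..k. mu j) * e)"
        by (simp add: sum_negf sum_distrib_right)
      finally show ?thesis
        unfolding inner_g_0[of w] w1 by (simp add: field_simps)
    qed
    ultimately show ?thesis
      by (simp add: A_apply inner_add_right field_simps)
  qed
  then show ?thesis by (rule nonneg_of_perturbation)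
qed

text \<open>If \<open>mu 1 = 0\<close>, the gradient in \<open>x\<close> vanishes, so every short
  step into the ball shows the form of \<open>H\<close> to be nonnegative along it. Limits add the
  tangent directions, and evenness of the form adds the outward ones.\<close>

lemma mu_1_pos:
  assumes npsd: "\<not> pos_semidef H" and xs: "xs \<noteq> 0"
  shows "mu 1 > 0"
proof (rule ccontr)
  assume "\<not> mu 1 > 0"
  then have "mu 1 = 0" using mu_nonneg[of 1] by simp
  then have g0: "H *v xs + c = 0" using grad_quadratic by simp
  obtain e where e: "e > 0"
    "\<And>u. norm u < e \<Longrightarrow> (xs + u) \<bullet> (xs + u) + f 1 ys \<le> 0 \<Longrightarrow>
      0 \<le> (H *v xs + c) \<bullet> u + 1/2 * (u \<bullet> (H *v u))"
    using quadratic_local_min by blast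
  have inward: "0 \<le> v \<bullet> (H *v v)" if v: "v \<bullet> xs < 0" for v
  proof -
    have v0: "v \<noteq> 0" using v by auto
    \<comment> \<open>The first bound keeps the step shorter than \<open>e\<close>; the second is
      the parameter at which the ray from \<open>xs\<close> leaves the ball again.\<close>
    define t where "t = min (e / (2 * norm v)) (- 2 * (v \<bullet> xs) / (v \<bullet> v))"
    have t: "t > 0" "t \<le> e / (2 * norm v)" "t \<le> - 2 * (v \<bullet> xs) / (v \<bullet> v)"
      using v v0 e(1) by (auto simp: t_def divide_neg_pos)
    have "norm (t *\<^sub>R v) \<le> e / 2"
      using t v0 by (simp add: field_simps)
    then have "norm (t *\<^sub>R v) < e" using e(1) by simp
    moreover have "(xs + t *\<^sub>R v) \<bullet> (xs + t *\<^sub>R v) + f 1 ys \<le> 0"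
    proof -
      have "t * (v \<bullet> v) + 2 * (v \<bullet> xs) \<le> 0"
        using t(3) v0 pos_le_divide_eq[of "v \<bullet> v" t "- 2 * (v \<bullet> xs)"]
        unfolding inner_gt_zero_iff by linarith
      then have "t * (t * (v \<bullet> v) + 2 * (v \<bullet> xs)) \<le> 0"
        using t(1) by (simp add: mult_nonneg_nonpos)
      then show ?thesis
        using active by (simp add: inner_add_left inner_add_right inner_commute algebra_simps)
    qed
    ultimately have "0 \<le> (H *v xs + c) \<bullet> (t *\<^sub>R v) + 1/2 * ((t *\<^sub>R v) \<bullet> (H *v (t *\<^sub>R v)))"
      by (rule e(2))
    then have "0 \<le> t * (t * (v \<bullet> (H *v v)))"
      by (simp only: g0) (simp add: matrix_vector_mult_scaleR)
    with t(1) show ?thesis by (simp add: zero_le_mult_iff)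
  qed
  have half: "0 \<le> v \<bullet> (H *v v)" if v: "v \<bullet> xs \<le> 0" for v
  proof -
    have "0 \<le> v \<bullet> (H *v v) + (- 2 * (v \<bullet> (H *v xs))) * d + (xs \<bullet> (H *v xs)) * d\<^sup>2"
      if d: "d > 0" for d
    proof -
      have "v \<bullet> xs - d * (xs \<bullet> xs) < 0"
        using v d xs by (smt (verit) inner_gt_zero_iff mult_pos_pos)
      then have "0 \<le> (v - d *\<^sub>R xs) \<bullet> (H *v (v - d *\<^sub>R xs))"
        by (intro inward) (simp add: inner_diff_left)
      then show ?thesis
        using symmetric_matrix_inner[OF sym, of xs v]
        by (simp add: matrix_vector_mult_diff_distrib matrix_vector_mult_scaleR inner_diff_left
            inner_diff_right inner_commute power2_eq_square algebra_simps)
    qed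
    then show ?thesis by (rule nonneg_of_perturbation)
  qed
  have "0 \<le> v \<bullet> (H *v v)" for v
  proof (cases "v \<bullet> xs \<le> 0")
    case False
    have "H *v (- v) = - (H *v v)"
      by (metis matrix_vector_mult_scaleR scaleR_minus1_left)
    then show ?thesis
      using half[of "- v"] False by simp
  qed (rule half)
  with npsd sym show False by (simp add: pos_semidef_def)
qed

lemma form_limit:
  "((\<lambda>t. (w + t *\<^sub>R z) \<bullet> (A *v (w + t *\<^sub>R z))) \<longlongrightarrow> w \<bullet> (A *v w)) (at 0)"
proof -
  have "((\<lambda>t. (w + t *\<^sub>R z) \<bullet> (A *v w + t *\<^sub>R (A *v z))) \<longlongrightarrow>
      (w + 0 *\<^sub>R z) \<bullet> (A *v w + 0 *\<^sub>R (A *v z))) (at 0)"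
    by (intro tendsto_intros)
  then show ?thesis
    by (simp add: matrix_vector_right_distrib matrix_vector_mult_scaleR)
qed

text \<open>Perturbing \<open>w\<close> by \<open>t *\<^sub>R xs\<close> makes it almost tangent but
  not tangent, where chords apply; then \<open>t\<close> tends to 0.\<close>

lemma tangent_nonneg:
  assumes "xs \<noteq> 0" "w \<bullet> xs = 0"
  shows "0 \<le> w \<bullet> (A *v w)"
proof (cases "w = 0")
  case False
  then have "\<forall>\<^sub>F t in at 0. 0 \<le> (w + t *\<^sub>R xs) \<bullet> (A *v (w + t *\<^sub>R xs))"
    using assms by (intro near_tangent_nonneg) auto
  with form_limit show ?thesis
    by (rule tendsto_lowerbound) simp
qed simp

text \<open>Pairing stationarity with \<open>v\<close> gives
  \<open>(l + mu 1) * (v \<bullet> xs) = 0\<close>. A negative factor would make \<open>v\<close>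
  tangent, with a negative value of the form.\<close>

lemma orthogonal_eigenvector_multiplier:
  assumes "xs \<noteq> 0" and v: "is_eigenvector H l v" "c \<bullet> v = 0"
  shows "0 \<le> l + mu 1"
proof (rule ccontr)
  assume neg: "\<not> 0 \<le> l + mu 1"
  have Av: "A *v v = (l + mu 1) *\<^sub>R v"
    using v(1) by (simp add: is_eigenvector_def A_apply scaleR_left_distrib)
  have "0 = v \<bullet> (A *v xs + c)"
    using stat_x by (simp add: A_def)
  also have "\<dots> = (l + mu 1) * (v \<bullet> xs)"
    using v(2) by (simp add: inner_add_right symmetric_matrix_inner[OF A_sym] Av inner_commute)
  finally have "v \<bullet> xs = 0" using neg by simp
  with assms(1) have "0 \<le> (l + mu 1) * (v \<bullet> v)"
    using tangent_nonneg[of v] by (simp add: Av)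
  moreover have "v \<bullet> v > 0" using v(1) by (simp add: is_eigenvector_def)
  ultimately show False using neg by (simp add: zero_le_mult_iff)
qed

text \<open>In the plane of two eigenvectors whose shifted eigenvalues are \<open>< 0\<close> and \<open>\<le> 0\<close>, the form of
  \<open>A\<close> is negative off one line; perturbing the tangent direction of that plane avoids this line.\<close>

lemma second_eigenvalue_multiplier:
  assumes xs: "xs \<noteq> 0" and v: "is_eigenvector H l v" and w: "is_eigenvector H l' w"
    and ortho: "v \<bullet> w = 0" and neg: "l + mu 1 < 0"
  shows "0 < l' + mu 1"
proof (rule ccontr)
  assume nonpos: "\<not> 0 < l' + mu 1"
  have vv: "v \<bullet> v > 0" and w0: "w \<bullet> w > 0"
    using v w by (auto simp: is_eigenvector_def)
  have Av: "A *v v = (l + mu 1) *\<^sub>R v" and Aw: "A *v w = (l' + mu 1) *\<^sub>R w"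
    using v w by (auto simp: is_eigenvector_def A_apply scaleR_left_distrib)
  have "v \<bullet> xs \<noteq> 0"
  proof
    assume "v \<bullet> xs = 0"
    from tangent_nonneg[OF xs this] have "0 \<le> (l + mu 1) * (v \<bullet> v)" by (simp add: Av)
    with mult_neg_pos[OF neg vv] show False by simp
  qed
  define a where "a = v \<bullet> xs"
  define b where "b = w \<bullet> xs"
  \<comment> \<open>The combination of \<open>w\<close> and \<open>v\<close> orthogonal to
    \<open>xs\<close>. Adding \<open>t *\<^sub>R v\<close> leaves \<open>t - b\<close> as the
    coefficient of \<open>v\<close>, so only \<open>t = b\<close> has to be avoided.\<close>
  define p where "p = a *\<^sub>R w - b *\<^sub>R v"
  have "p \<bullet> w = a * (w \<bullet> w)"
    using ortho by (simp add: p_def inner_diff_left)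
  then have "p \<noteq> 0" using \<open>v \<bullet> xs \<noteq> 0\<close> w0 by (auto simp: a_def)
  moreover have "p \<bullet> xs = 0"
    by (simp add: p_def inner_diff_left a_def b_def)
  ultimately have "\<forall>\<^sub>F t in at 0. 0 \<le> (p + t *\<^sub>R v) \<bullet> (A *v (p + t *\<^sub>R v))"
    using \<open>v \<bullet> xs \<noteq> 0\<close> by (rule near_tangent_nonneg)
  moreover have "\<forall>\<^sub>F t in at 0. t \<noteq> b"
    by (rule eventually_neq_at_within)
  ultimately have "\<forall>\<^sub>F t::real in at 0. False"
  proof eventually_elim
    case (elim t)
    have "p + t *\<^sub>R v = a *\<^sub>R w + (t - b) *\<^sub>R v"
      by (simp add: p_def algebra_simps)
    moreover have "(a *\<^sub>R w + (t - b) *\<^sub>R v) \<bullet> (A *v (a *\<^sub>R w + (t - b) *\<^sub>R v)) =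
        a\<^sup>2 * ((l' + mu 1) * (w \<bullet> w)) + (t - b)\<^sup>2 * ((l + mu 1) * (v \<bullet> v))"
      using ortho by (simp add: matrix_vector_right_distrib matrix_vector_mult_scaleR Av Aw
          inner_add_left inner_add_right inner_commute power2_eq_square)
    moreover have "a\<^sup>2 * ((l' + mu 1) * (w \<bullet> w)) \<le> 0"
      using nonpos w0 by (simp add: mult_nonneg_nonpos mult_nonpos_nonneg)
    moreover have "(t - b)\<^sup>2 * ((l + mu 1) * (v \<bullet> v)) < 0"
      using elim(2) neg vv by (simp add: mult_pos_neg mult_neg_pos)
    ultimately show False using elim(1) by simp
  qed
  then show False by simp
qed

end

theorem theorem4:
  fixes H :: "real^'n^'n" and c xs :: "real^'n" and ys :: "real^'m"
    and f :: "nat \<Rightarrow> real^'m \<Rightarrow> real" and k :: nat and lam :: "nat \<Rightarrow> real"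
  assumes n_ge_2: "CARD('n) \<ge> 2"
    and k_ge_1: "k \<ge> 1"
    and H_sym: "transpose H = H"
    and H_not_psd: "\<not> pos_semidef H"
    and f_convex: "\<And>j. j \<le> k \<Longrightarrow> convex_on UNIV (f j)"
    and f_C2: "\<And>j. j \<le> k \<Longrightarrow> twice_cont_diff (f j)"
    and eigs: "ordered_eigenvalues H lam"
    and lngm: "local_nonglobal_minimizer (objective H c f) (feasible_set k f) (xs, ys)"
    and licq: "lin_indep_family (\<lambda>i. gradient (f i) ys) {j \<in> {1..k}. f j ys = 0}"
  shows "lam 1 < lam 2 \<and>
    (\<exists>mu :: nat \<Rightarrow> real.
       (\<forall>j\<in>{1..k}. 0 \<le> mu j) \<and>
       max 0 (- lam 2) < mu 1 \<and> mu 1 < - lam 1 \<and>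
       (H + mu 1 *\<^sub>R mat 1) *v xs + c = 0 \<and>
       gradient (f 0) ys + (mu 1 / 2) *\<^sub>R gradient (f 1) ys
         + (\<Sum>j = 2..k. mu j *\<^sub>R gradient (f j) ys) = 0 \<and>
       xs \<bullet> xs + f 1 ys = 0 \<and>
       (\<forall>j\<in>{2..k}. mu j * f j ys = 0)) \<and>
    (\<forall>v. is_eigenvector H (lam 1) v \<longrightarrow> \<not> orthogonal c v)"
proof -
  interpret local_min H c xs ys f "\<lambda>j. gradient (f j) ys" k
    by unfold_locales
      (use k_ge_1 H_sym f_C2 lngm in
        \<open>auto simp: local_nonglobal_minimizer_def intro: twice_cont_diff_GDERIV\<close>)
  note act = ball_constraint_active[OF H_not_psd]
  obtain mu where mu: "\<And>j. 0 \<le> mu j" "(H + mu 1 *\<^sub>R mat 1) *v xs + c = 0"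
    "gradient (f 0) ys + (mu 1 / 2) *\<^sub>R gradient (f 1) ys
      + (\<Sum>j = 2..k. mu j *\<^sub>R gradient (f j) ys) = 0"
    "\<And>j. j \<in> {2..k} \<Longrightarrow> mu j * f j ys = 0"
    using kkt[OF act licq] by blast
  interpret kkt_point H c xs ys f "\<lambda>j. gradient (f j) ys" k mu
    by unfold_locales (use act mu in auto)
  have indef: "\<exists>u. u \<bullet> (A *v u) < 0"
    using global_of_nonneg[OF f_convex] lngm
    unfolding local_nonglobal_minimizer_def by (meson not_le)
  then have xs: "xs \<noteq> 0"
    using nonneg_at_origin[OF licq] by (meson not_le)
  obtain u where u: "u \<bullet> (A *v u) < 0" using indef by blast
  have "lam 1 * (u \<bullet> u) \<le> u \<bullet> (H *v u)"
    by (rule ordered_eigenvalues_quadratic_form_ge[OF H_sym eigs])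
  with u have "(lam 1 + mu 1) * (u \<bullet> u) < 0"
    by (simp add: A_apply inner_add_right distrib_right)
  then have lam1: "lam 1 + mu 1 < 0"
    by (smt (verit) inner_ge_zero mult_nonneg_nonneg)
  obtain v w where vw: "is_eigenvector H (lam 1) v" "is_eigenvector H (lam 2) w" "v \<bullet> w = 0"
    using ordered_eigenvalues_orthogonal_pair[OF H_sym eigs n_ge_2] by blast
  have lam2: "0 < lam 2 + mu 1"
    by (rule second_eigenvalue_multiplier[OF xs vw lam1])
  have "\<not> orthogonal c v" if "is_eigenvector H (lam 1) v" for v
    using orthogonal_eigenvector_multiplier[OF xs that] lam1 by (auto simp: orthogonal_def)
  moreover have "max 0 (- lam 2) < mu 1"
    using lam2 mu_1_pos[OF H_not_psd xs] by simp
  \<comment> \<open>The gap \<open>lam 1 < lam 2\<close> holds because \<open>- mu 1\<close> lies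
    strictly between the two.\<close>
  ultimately show ?thesis
    using lam1 lam2 mu act by (intro conjI exI[of _ mu]) auto
qed

end
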